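(* Let $(\mathcal{M},\overset{p}{\longmapsto},Emb)$ be a target for a prefactor system with embeddings $(\mathcal{M}_{\mathcal{I}},\overset{p}{\mapsto},emb)$. For $i\in\mathcal{I}$ define, on $\mathcal{M}$, $$a\approx_i b:\iff a\overset{p}{\longmapsto}a_i\text{ and }b\overset{p}{\longmapsto}b_i\text{ for some }a_i\asymp b_i\text{ in }\mathcal{M}_i,$$ $\mathcal{P}_i:=\{Emb_i(a_i)\mid a_i\in\mathcal{M}_i\}$, and $$pt_i(a)=b:\iff a\overset{p}{\longmapsto}a_i\text{ and }b=Emb_i(a_i)\text{ for some }a_i\in\mathcal{M}_i .$$ Then $(\mathcal{M},\approx_{\mathcal{I}},pt_{\mathcal{I}})$ is a pointed $\mathfrak{D}$-set. In particular, for all $i\le i'$, $a_i,b_i\in\mathcal{M}_i$, $a_{i'}\in\mathcal{M}_{i'}$: 1. $a_i\asymp b_i\iff Emb_i(a_i)=Emb_i(b_i)$; 2. $a_{i'}\overset{p}{\mapsto}a_i\Rightarrow pt_i(Emb_{i'}(a_{i'}))=Emb_i(a_i)$, and if $\mathcal{M}_{\mathcal{I}}$ is stable, the inverse implication holds as well. If $\mathcal{M}_{\mathcal{I}}$ is stable, then $Emb=(Emb_i)_{i\in\mathcal{I}}:\mathcal{M}_{\mathcal{I}}\to\mathcal{AP}(\mathcal{M})$ (with the identity on $\mathcal{I}$) is a strong and surjective homomorphism of prefactor systems with embeddings; and if $\mathcal{M}_{\mathcal{I}}$ satisfies $a_i\asymp b_i\iff a_i\overset{p}{\mapsto}b_i\iff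 a_i=b_i$ for all $i\in\mathcal{I}$, $a_i,b_i\in\mathcal{M}_i$, then $Emb$ is an isomorphism.
   Context: Index sets $\mathcal{I},\mathcal{J},\dots$ are non-empty directed preordered sets (products carry the product order). For each index set $\mathcal{I}$ (including products) a set $\mathfrak{D}(\mathcal{I})\subseteq\mathcal{P}(\mathcal{I})$ is fixed. Standing assumptions: $\mathfrak{D}(\mathcal{I})$ is a proper filter of subsets of $\mathcal{I}$, all of whose members are cofinal, and it contains all non-empty up-sets; and if $\mathcal{H}\in\mathfrak{D}(\mathcal{I}\times\mathcal{J})$ and $\mathcal{I}'\in\mathfrak{D}(\mathcal{I})$, then $\{j\in\mathcal{J}\mid\exists i\in\mathcal{I}'\ (i,j)\in\mathcal{H}\}\in\mathfrak{D}(\mathcal{J})$. A system $(\mathcal{M}_{\mathcal{I}},\overset{p}{\mapsto})$ is a family of finite sets $(\mathcal{M}_i)_{i\in\mathcal{I}}$ (regarded as disjoint) with relations $\overset{p}{\mapsto}\subseteq\mathcal{M}_{i'}\times\mathcal{M}_i$ for $i'\ge i$, reflexive for $i=i'$. Elements $a_i\in\mathcal{M}_i$, $b_j\in\mathcal{M}_j$ are consistent, $a_i\asymp b_j$, iff there are $i'\ge i,j$ and $a_{i'}\in\mathcal{M}_{i'}$ with $a_{i'}\overset{p}{\mapsto}a_i$ and $a_{i'}\overset{p}{\mapsto}b_j$. A prefactor system is a system with $a_{i'}\asymp a_i\iff a_{i'}\overset{p}{\mapsto}a_i$ for all $i\le i'$. A system is stable iff $a_{i'}\overset{p}{\mapsto}a_i\asymp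 b_i$ implies $a_{i'}\overset{p}{\mapsto}b_i$ for all $i\le i'$. A prefactor system with embeddings $(\mathcal{M}_{\mathcal{I}},\overset{p}{\mapsto},emb)$ is a prefactor system with maps $emb_i^{i'}:\mathcal{M}_i\to\mathcal{M}_{i'}$ ($i\le i'$) preserving $\asymp$ (i.e. $a_i\asymp b_i$ implies $emb_i^{i'}(a_i)\asymp emb_i^{i'}(b_i)$), with $emb_i^i(a_i)\asymp a_i$, $emb_{i'}^{i''}(emb_i^{i'}(a_i))\asymp emb_i^{i''}(a_i)$, and coherent: $a_{i'}\overset{p}{\mapsto}a_i\Rightarrow emb_{i'}^{i''}(a_{i'})\overset{p}{\mapsto}a_i$ for $i\le i'\le i''$. A target $(\mathcal{M},\overset{p}{\longmapsto},Emb)$ for it is a set $\mathcal{M}$ with relations $\overset{p}{\longmapsto}\subseteq\mathcal{M}\times\mathcal{M}_i$ and maps $Emb_i:\mathcal{M}_i\to\mathcal{M}$ such that: $\{i\in\mathcal{I}\mid\exists a_i\in\mathcal{M}_i\ a\overset{p}{\longmapsto}a_i\}\in\mathfrak{D}(\mathcal{I})$ for all $a\in\mathcal{M}$; $a\overset{p}{\longmapsto}a_{i'}$ and $a\overset{p}{\longmapsto}a_i$ imply $a_{i'}\overset{p}{\mapsto}a_i$ for $i\le i'$; $a_i\asymp b_i$ implies $Emb_i(a_i)=Emb_i(b_i)$; $Emb_{i'}(emb_i^{i'}(a_i))=Emb_i(a_i)$; and $a_{i'}\overset{p}{\mapsto}a_i$ implies $Emb_{i'}(a_{i'})\overset{p}{\longmapsto}a_i$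 for $i\le i'$. For PERs (symmetric, transitive relations) $\approx_i$ on $\mathcal{M}$ put $[i]:=\{a\in\mathcal{M}\mid a\approx_i a\}$, $\mathcal{I}_a:=\{i\mid a\in[i]\}$. $(\mathcal{M},\approx_{\mathcal{I}})$ is a $\mathfrak{D}$-set iff each $\approx_i$ is a PER; $\mathcal{I}_a\in\mathfrak{D}(\mathcal{I})$ for all $a$; and $a\approx_{i'}b$, $a,b\in[i]$ imply $a\approx_i b$ for $i\le i'$. It is pointed, with $pt_{\mathcal{I}}$, iff there are $\mathcal{P}_i\subseteq\mathcal{M}$ and surjective maps $pt_i:[i]\to\mathcal{P}_i$ such that for all $a,b$ and $i\le i'$: $\mathcal{P}_i\subseteq\mathcal{P}_{i'}$; $a\approx_i b$ implies $a\approx_i pt_i(a)=pt_i(b)$; $a\in[i]\cap[i']$ implies $pt_{i'}(a)\in[i]$. The internal system $\mathcal{AP}(\mathcal{M})$ of a pointed $\mathfrak{D}$-set is $((\mathcal{P}_i)_{i\in\mathcal{I}},\overset{p}{\mapsto})$ with $a_{i'}\overset{p}{\mapsto}a_i:\iff a_{i'}\approx_i a_i$ (equivalently $a_{i'}\in[i]$ and $pt_i(a_{i'})=a_i$) for $a_{i'}\in\mathcal{P}_{i'}$, $a_i\in\mathcal{P}_i$, $i\le i'$, with embeddings the inclusions $\mathcal{P}_i\hookrightarrow\mathcal{P}_{i'}$. A homomorphism between prefactor systems with embeddings $\mathcal{M}_{\mathcal{I}}$, $\mathcal{N}_{\mathcal{J}}$ consists of a monotone map $\Phi_0:\mathcal{I}\to\mathcal{J}$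 and maps $\Phi^i:\mathcal{M}_i\to\mathcal{N}_{\Phi_0(i)}$ such that $a_{i'}\overset{p}{\mapsto}a_i\Rightarrow\Phi^{i'}(a_{i'})\overset{p}{\mapsto}\Phi^i(a_i)$ and $\Phi^{i'}(emb_i^{i'}(a_i))=emb_{\Phi_0(i)}^{\Phi_0(i')}(\Phi^i(a_i))$ for $i\le i'$. It is strong if the first implication is an equivalence, surjective if all its maps are surjective, and an isomorphism if it has an inverse homomorphism (componentwise). *)

theory Defs
  imports Main
begin

section \<open>Index sets\<close>

text \<open>An index set is given by its preorder relation; the underlying set is its \<^const>\<open>Field\<close>,
  and \<open>(i, i') \<in> I\<close> means \<open>i \<le> i'\<close>.\<close>

definition index_set :: "'i rel \<Rightarrow> bool" where
  "index_set I \<longleftrightarrow> Preorder I \<and> Field I \<noteq> {} \<and>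
     (\<forall>i\<in>Field I. \<forall>j\<in>Field I. \<exists>k. (i, k) \<in> I \<and> (j, k) \<in> I)"

definition cofinal :: "'i rel \<Rightarrow> 'i set \<Rightarrow> bool" where
  "cofinal I H \<longleftrightarrow> H \<subseteq> Field I \<and> (\<forall>i\<in>Field I. \<exists>h\<in>H. (i, h) \<in> I)"

definition up_set :: "'i rel \<Rightarrow> 'i set \<Rightarrow> bool" where
  "up_set I U \<longleftrightarrow> U \<subseteq> Field I \<and> (\<forall>i\<in>U. \<forall>i'. (i, i') \<in> I \<longrightarrow> i' \<in> U)"

definition proper_filter_on :: "'i set \<Rightarrow> 'i set set \<Rightarrow> bool" where
  "proper_filter_on X F \<longleftrightarrow> F \<subseteq> Pow X \<and> X \<in> F \<and> {} \<notin> F \<and>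
     (\<forall>A\<in>F. \<forall>B\<in>F. A \<inter> B \<in> F) \<and>
     (\<forall>A\<in>F. \<forall>B. A \<subseteq> B \<and> B \<subseteq> X \<longrightarrow> B \<in> F)"

text \<open>The family \<open>\<DD>\<close> assigns a filter to every index set, including products. In order that
  \<open>I\<close>, \<open>J\<close> and \<open>I \<times> J\<close> are index sets over one and the same type, indices are taken from a type
  with an internal pairing constructor.\<close>

datatype 'u index = Atom 'u | Tup "'u index" "'u index"

definition prod_index :: "'u index rel \<Rightarrow> 'u index rel \<Rightarrow> 'u index rel" where
  "prod_index I J = {(Tup i j, Tup i' j') | i i' j j'. (i, i') \<in> I \<and> (j, j') \<in> J}"

definition filter_family :: "('u index rel \<Rightarrow> 'u index set set) \<Rightarrow> bool" where
  "filter_family \<DD> \<longleftrightarrow>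
     (\<forall>I. index_set I \<longrightarrow>
        proper_filter_on (Field I) (\<DD> I) \<and>
        (\<forall>H\<in>\<DD> I. cofinal I H) \<and>
        (\<forall>U. up_set I U \<and> U \<noteq> {} \<longrightarrow> U \<in> \<DD> I)) \<and>
     (\<forall>I J. index_set I \<and> index_set J \<longrightarrow>
        (\<forall>H\<in>\<DD> (prod_index I J). \<forall>I'\<in>\<DD> I.
           {j \<in> Field J. \<exists>i\<in>I'. Tup i j \<in> H} \<in> \<DD> J))"


section \<open>Prefactor systems\<close>

text \<open>The sets \<open>elems S i\<close> may overlap; they are regarded as disjoint in that every relation and map
  carries the indices of its arguments: \<open>proj S i' i a' a\<close> reads \<open>a' \<mapsto> a\<close> for
  \<open>a' \<in> elems S i'\<close>, \<open>a \<in> elems S i\<close>, \<open>i \<le> i'\<close>.\<close>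

record ('i, 'm) system =
  idx :: "'i rel"
  elems :: "'i \<Rightarrow> 'm set"
  proj :: "'i \<Rightarrow> 'i \<Rightarrow> 'm \<Rightarrow> 'm \<Rightarrow> bool"

record ('i, 'm) system_emb = "('i, 'm) system" +
  emb :: "'i \<Rightarrow> 'i \<Rightarrow> 'm \<Rightarrow> 'm"  \<comment> \<open>\<open>emb S i i'\<close> maps \<open>elems S i\<close> to \<open>elems S i'\<close>\<close>

definition is_system :: "('i, 'm, 'z) system_scheme \<Rightarrow> bool" where
  "is_system S \<longleftrightarrow> index_set (idx S) \<and>
     (\<forall>i\<in>Field (idx S). finite (elems S i)) \<and>
     (\<forall>i i' a' a. (i, i') \<in> idx S \<and> proj S i' i a' a \<longrightarrow> a' \<in> elems S i' \<and> a \<in> elems S i) \<and>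
     (\<forall>i\<in>Field (idx S). \<forall>a\<in>elems S i. proj S i i a a)"

text \<open>\<open>consistent S i j a b\<close> reads \<open>a \<asymp> b\<close> for \<open>a \<in> elems S i\<close> and \<open>b \<in> elems S j\<close>.\<close>

definition consistent :: "('i, 'm, 'z) system_scheme \<Rightarrow> 'i \<Rightarrow> 'i \<Rightarrow> 'm \<Rightarrow> 'm \<Rightarrow> bool" where
  "consistent S i j a b \<longleftrightarrow>
     (\<exists>k. (i, k) \<in> idx S \<and> (j, k) \<in> idx S \<and> (\<exists>c\<in>elems S k. proj S k i c a \<and> proj S k j c b))"

definition prefactor_system :: "('i, 'm, 'z) system_scheme \<Rightarrow> bool" where
  "prefactor_system S \<longleftrightarrow> is_system S \<and>
     (\<forall>i i'. (i, i') \<in> idx S \<longrightarrow>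
        (\<forall>a'\<in>elems S i'. \<forall>a\<in>elems S i. consistent S i' i a' a \<longleftrightarrow> proj S i' i a' a))"

definition stable :: "('i, 'm, 'z) system_scheme \<Rightarrow> bool" where
  "stable S \<longleftrightarrow>
     (\<forall>i i'. (i, i') \<in> idx S \<longrightarrow>
        (\<forall>a'\<in>elems S i'. \<forall>a\<in>elems S i. \<forall>b\<in>elems S i.
           proj S i' i a' a \<and> consistent S i i a b \<longrightarrow> proj S i' i a' b))"

definition prefactor_system_emb :: "('i, 'm, 'z) system_emb_scheme \<Rightarrow> bool" where
  "prefactor_system_emb S \<longleftrightarrow> prefactor_system S \<and>
     (\<forall>i i'. (i, i') \<in> idx S \<longrightarrow> emb S i i' ` elems S i \<subseteq> elems S i') \<and>
     (\<forall>i i'. (i, i') \<in> idx S \<longrightarrow>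
        (\<forall>a\<in>elems S i. \<forall>b\<in>elems S i.
           consistent S i i a b \<longrightarrow> consistent S i' i' (emb S i i' a) (emb S i i' b))) \<and>
     (\<forall>i\<in>Field (idx S). \<forall>a\<in>elems S i. consistent S i i (emb S i i a) a) \<and>
     (\<forall>i i' i''. (i, i') \<in> idx S \<and> (i', i'') \<in> idx S \<longrightarrow>
        (\<forall>a\<in>elems S i. consistent S i'' i'' (emb S i' i'' (emb S i i' a)) (emb S i i'' a))) \<and>
     (\<forall>i i' i''. (i, i') \<in> idx S \<and> (i', i'') \<in> idx S \<longrightarrow>
        (\<forall>a'\<in>elems S i'. \<forall>a\<in>elems S i.
           proj S i' i a' a \<longrightarrow> proj S i'' i (emb S i' i'' a') a))"


section \<open>Homomorphisms\<close>

definition homomorphism ::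
  "('i, 'm, 'y) system_emb_scheme \<Rightarrow> ('j, 'n, 'z) system_emb_scheme \<Rightarrow>
   ('i \<Rightarrow> 'j) \<Rightarrow> ('i \<Rightarrow> 'm \<Rightarrow> 'n) \<Rightarrow> bool" where
  "homomorphism S T \<phi> \<Phi> \<longleftrightarrow> prefactor_system_emb S \<and> prefactor_system_emb T \<and>
     \<phi> ` Field (idx S) \<subseteq> Field (idx T) \<and>
     (\<forall>i i'. (i, i') \<in> idx S \<longrightarrow> (\<phi> i, \<phi> i') \<in> idx T) \<and>
     (\<forall>i\<in>Field (idx S). \<Phi> i ` elems S i \<subseteq> elems T (\<phi> i)) \<and>
     (\<forall>i i'. (i, i') \<in> idx S \<longrightarrow>
        (\<forall>a'\<in>elems S i'. \<forall>a\<in>elems S i.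
           proj S i' i a' a \<longrightarrow> proj T (\<phi> i') (\<phi> i) (\<Phi> i' a') (\<Phi> i a)) \<and>
        (\<forall>a\<in>elems S i. \<Phi> i' (emb S i i' a) = emb T (\<phi> i) (\<phi> i') (\<Phi> i a)))"

definition strong_homomorphism ::
  "('i, 'm, 'y) system_emb_scheme \<Rightarrow> ('j, 'n, 'z) system_emb_scheme \<Rightarrow>
   ('i \<Rightarrow> 'j) \<Rightarrow> ('i \<Rightarrow> 'm \<Rightarrow> 'n) \<Rightarrow> bool" where
  "strong_homomorphism S T \<phi> \<Phi> \<longleftrightarrow> homomorphism S T \<phi> \<Phi> \<and>
     (\<forall>i i'. (i, i') \<in> idx S \<longrightarrow>
        (\<forall>a'\<in>elems S i'. \<forall>a\<in>elems S i.
           proj S i' i a' a \<longleftrightarrow> proj T (\<phi> i') (\<phi> i) (\<Phi> i' a') (\<Phi> i a)))"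

definition surjective_homomorphism ::
  "('i, 'm, 'y) system_emb_scheme \<Rightarrow> ('j, 'n, 'z) system_emb_scheme \<Rightarrow>
   ('i \<Rightarrow> 'j) \<Rightarrow> ('i \<Rightarrow> 'm \<Rightarrow> 'n) \<Rightarrow> bool" where
  "surjective_homomorphism S T \<phi> \<Phi> \<longleftrightarrow> homomorphism S T \<phi> \<Phi> \<and>
     \<phi> ` Field (idx S) = Field (idx T) \<and>
     (\<forall>i\<in>Field (idx S). \<Phi> i ` elems S i = elems T (\<phi> i))"

definition isomorphism ::
  "('i, 'm, 'y) system_emb_scheme \<Rightarrow> ('j, 'n, 'z) system_emb_scheme \<Rightarrow>
   ('i \<Rightarrow> 'j) \<Rightarrow> ('i \<Rightarrow> 'm \<Rightarrow> 'n) \<Rightarrow> bool" where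
  "isomorphism S T \<phi> \<Phi> \<longleftrightarrow> homomorphism S T \<phi> \<Phi> \<and>
     (\<exists>\<psi> \<Psi>. homomorphism T S \<psi> \<Psi> \<and>
        (\<forall>i\<in>Field (idx S). \<psi> (\<phi> i) = i \<and> (\<forall>a\<in>elems S i. \<Psi> (\<phi> i) (\<Phi> i a) = a)) \<and>
        (\<forall>j\<in>Field (idx T). \<phi> (\<psi> j) = j \<and> (\<forall>b\<in>elems T j. \<Phi> (\<psi> j) (\<Psi> j b) = b)))"


section \<open>Targets\<close>

record ('i, 'm, 'a) target =
  pts :: "'a set"
  tproj :: "'i \<Rightarrow> 'a \<Rightarrow> 'm \<Rightarrow> bool"  \<comment> \<open>\<open>tproj T i a x\<close> reads \<open>a \<longmapsto> x\<close> for \<open>x \<in> elems S i\<close>\<close>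
  Emb :: "'i \<Rightarrow> 'm \<Rightarrow> 'a"

definition is_target ::
  "('i rel \<Rightarrow> 'i set set) \<Rightarrow> ('i, 'm, 'z) system_emb_scheme \<Rightarrow> ('i, 'm, 'a) target \<Rightarrow> bool" where
  "is_target \<DD> S T \<longleftrightarrow>
     (\<forall>i\<in>Field (idx S). \<forall>a x. tproj T i a x \<longrightarrow> a \<in> pts T \<and> x \<in> elems S i) \<and>
     (\<forall>i\<in>Field (idx S). Emb T i ` elems S i \<subseteq> pts T) \<and>
     (\<forall>a\<in>pts T. {i \<in> Field (idx S). \<exists>x\<in>elems S i. tproj T i a x} \<in> \<DD> (idx S)) \<and>
     (\<forall>i i'. (i, i') \<in> idx S \<longrightarrow>
        (\<forall>a\<in>pts T. \<forall>x'\<in>elems S i'. \<forall>x\<in>elems S i.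
           tproj T i' a x' \<and> tproj T i a x \<longrightarrow> proj S i' i x' x)) \<and>
     (\<forall>i\<in>Field (idx S). \<forall>x\<in>elems S i. \<forall>y\<in>elems S i.
        consistent S i i x y \<longrightarrow> Emb T i x = Emb T i y) \<and>
     (\<forall>i i'. (i, i') \<in> idx S \<longrightarrow>
        (\<forall>x\<in>elems S i. Emb T i' (emb S i i' x) = Emb T i x)) \<and>
     (\<forall>i i'. (i, i') \<in> idx S \<longrightarrow>
        (\<forall>x'\<in>elems S i'. \<forall>x\<in>elems S i. proj S i' i x' x \<longrightarrow> tproj T i (Emb T i' x') x))"


section \<open>Pointed \<open>\<DD>\<close>-sets and their internal systems\<close>

definition per_on :: "'a set \<Rightarrow> ('a \<Rightarrow> 'a \<Rightarrow> bool) \<Rightarrow> bool" where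
  "per_on M R \<longleftrightarrow> (\<forall>a b. R a b \<longrightarrow> a \<in> M \<and> b \<in> M) \<and> symp R \<and> transp R"

text \<open>The domain \<open>[i]\<close> of the partial equivalence relation \<open>E i\<close>.\<close>

definition dom_at :: "'a set \<Rightarrow> ('i \<Rightarrow> 'a \<Rightarrow> 'a \<Rightarrow> bool) \<Rightarrow> 'i \<Rightarrow> 'a set" where
  "dom_at M E i = {a \<in> M. E i a a}"

definition D_set ::
  "('i rel \<Rightarrow> 'i set set) \<Rightarrow> 'i rel \<Rightarrow> 'a set \<Rightarrow> ('i \<Rightarrow> 'a \<Rightarrow> 'a \<Rightarrow> bool) \<Rightarrow> bool" where
  "D_set \<DD> I M E \<longleftrightarrow> index_set I \<and>
     (\<forall>i\<in>Field I. per_on M (E i)) \<and>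
     (\<forall>a\<in>M. {i \<in> Field I. a \<in> dom_at M E i} \<in> \<DD> I) \<and>
     (\<forall>i i'. (i, i') \<in> I \<longrightarrow>
        (\<forall>a b. E i' a b \<and> a \<in> dom_at M E i \<and> b \<in> dom_at M E i \<longrightarrow> E i a b))"

text \<open>Only the values of \<open>pt i\<close> on \<open>[i]\<close> matter.\<close>

definition pointed_D_set ::
  "('i rel \<Rightarrow> 'i set set) \<Rightarrow> 'i rel \<Rightarrow> 'a set \<Rightarrow> ('i \<Rightarrow> 'a \<Rightarrow> 'a \<Rightarrow> bool) \<Rightarrow>
   ('i \<Rightarrow> 'a set) \<Rightarrow> ('i \<Rightarrow> 'a \<Rightarrow> 'a) \<Rightarrow> bool" where
  "pointed_D_set \<DD> I M E P pt \<longleftrightarrow> D_set \<DD> I M E \<and>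
     (\<forall>i\<in>Field I. P i \<subseteq> M \<and> pt i ` dom_at M E i = P i) \<and>
     (\<forall>i i'. (i, i') \<in> I \<longrightarrow> P i \<subseteq> P i') \<and>
     (\<forall>i\<in>Field I. \<forall>a b. E i a b \<longrightarrow> E i a (pt i a) \<and> pt i a = pt i b) \<and>
     (\<forall>i i'. (i, i') \<in> I \<longrightarrow>
        (\<forall>a\<in>dom_at M E i \<inter> dom_at M E i'. pt i' a \<in> dom_at M E i))"

definition internal_system ::
  "'i rel \<Rightarrow> ('i \<Rightarrow> 'a \<Rightarrow> 'a \<Rightarrow> bool) \<Rightarrow> ('i \<Rightarrow> 'a set) \<Rightarrow> ('i, 'a) system_emb" where
  "internal_system I E P =
     \<lparr>idx = I, elems = P,
      proj = (\<lambda>i' i a' a. (i, i') \<in> I \<and> a' \<in> P i' \<and> a \<in> P i \<and> E i a' a),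
      emb = (\<lambda>i i' a. a)\<rparr>"


section \<open>The structure induced on a target\<close>

definition target_eq ::
  "('i, 'm, 'z) system_emb_scheme \<Rightarrow> ('i, 'm, 'a) target \<Rightarrow> 'i \<Rightarrow> 'a \<Rightarrow> 'a \<Rightarrow> bool" where
  "target_eq S T i a b \<longleftrightarrow> a \<in> pts T \<and> b \<in> pts T \<and>
     (\<exists>x\<in>elems S i. \<exists>y\<in>elems S i. tproj T i a x \<and> tproj T i b y \<and> consistent S i i x y)"

definition target_P ::
  "('i, 'm, 'z) system_emb_scheme \<Rightarrow> ('i, 'm, 'a) target \<Rightarrow> 'i \<Rightarrow> 'a set" where
  "target_P S T i = Emb T i ` elems S i"

text \<open>The relation defining \<open>pt\<^sub>i(a) = b\<close>. That it is the graph of a function with domain \<open>[i]\<close>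
  needs proof, and \<open>target_pt\<close> is meaningful only on \<open>[i]\<close>.\<close>

definition target_pt_graph ::
  "('i, 'm, 'z) system_emb_scheme \<Rightarrow> ('i, 'm, 'a) target \<Rightarrow> 'i \<Rightarrow> 'a \<Rightarrow> 'a \<Rightarrow> bool" where
  "target_pt_graph S T i a b \<longleftrightarrow> (\<exists>x\<in>elems S i. tproj T i a x \<and> b = Emb T i x)"

definition target_pt ::
  "('i, 'm, 'z) system_emb_scheme \<Rightarrow> ('i, 'm, 'a) target \<Rightarrow> 'i \<Rightarrow> 'a \<Rightarrow> 'a" where
  "target_pt S T i a = (THE b. target_pt_graph S T i a b)"

abbreviation target_dom ::
  "('i, 'm, 'z) system_emb_scheme \<Rightarrow> ('i, 'm, 'a) target \<Rightarrow> 'i \<Rightarrow> 'a set" where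
  "target_dom S T \<equiv> dom_at (pts T) (target_eq S T)"

abbreviation target_AP ::
  "('i, 'm, 'z) system_emb_scheme \<Rightarrow> ('i, 'm, 'a) target \<Rightarrow> ('i, 'a) system_emb" where
  "target_AP S T \<equiv> internal_system (idx S) (target_eq S T) (target_P S T)"

end

theory Submission
  imports Defs
begin

text \<open>The whole argument rests on the equivalence of \<open>x \<asymp> y\<close> and \<open>Emb\<^sub>i x = Emb\<^sub>i y\<close>: since
  \<open>Emb\<^sub>i x \<longmapsto> x\<close>, and any two projections at \<open>i\<close> of one point of the target are consistent, equal
  images come from consistent elements. Thus \<open>\<asymp>\<close> is an equivalence relation on each
  \<open>\<M>\<^sub>i\<close>, and \<open>a \<approx>\<^sub>i b\<close> says that \<open>a\<close> and \<open>b\<close> have the same image under \<open>pt\<^sub>i\<close>. If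
  \<open>Emb\<^sub>i\<^sub>' x' \<longmapsto> y\<close> with \<open>Emb\<^sub>i y = Emb\<^sub>i x\<close>, then \<open>x' \<mapsto> y \<asymp> x\<close>, so stability is exactly what makes
  \<open>Emb\<close> reflect \<open>\<mapsto>\<close>.\<close>

section \<open>Pointed \<open>\<DD>\<close>-sets: consequences of the axioms\<close>

lemma index_set_refl: "index_set I \<Longrightarrow> i \<in> Field I \<Longrightarrow> (i, i) \<in> I"
  by (auto simp: index_set_def preorder_on_def refl_on_def)

lemma pointed_D_setD:
  assumes "pointed_D_set \<DD> I M E P pt"
  shows "index_set I"
    and "i \<in> Field I \<Longrightarrow> per_on M (E i)"
    and "i \<in> Field I \<Longrightarrow> pt i ` dom_at M E i = P i"
    and "(i, i') \<in> I \<Longrightarrow> P i \<subseteq> P i'"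
    and "i \<in> Field I \<Longrightarrow> E i a b \<Longrightarrow> E i a (pt i a)"
    and "i \<in> Field I \<Longrightarrow> E i a b \<Longrightarrow> pt i a = pt i b"
    and "(i, i') \<in> I \<Longrightarrow> a \<in> dom_at M E i \<Longrightarrow> a \<in> dom_at M E i' \<Longrightarrow> pt i' a \<in> dom_at M E i"
    and "(i, i') \<in> I \<Longrightarrow> E i' a b \<Longrightarrow> a \<in> dom_at M E i \<Longrightarrow> b \<in> dom_at M E i \<Longrightarrow> E i a b"
proof -
  have 1: "index_set I" "\<forall>i\<in>Field I. per_on M (E i)"
    "\<forall>i\<in>Field I. P i \<subseteq> M \<and> pt i ` dom_at M E i = P i"
    "\<forall>i i'. (i, i') \<in> I \<longrightarrow> P i \<subseteq> P i'"
    using assms unfolding pointed_D_set_def D_set_def by - (elim conjE, assumption)+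
  show "index_set I" by (fact 1)
  show "per_on M (E i)" "pt i ` dom_at M E i = P i" if "i \<in> Field I"
    using 1 that by blast+
  show "P i \<subseteq> P i'" if "(i, i') \<in> I"
    using 1(4) that by blast
  have 2: "\<forall>i\<in>Field I. \<forall>a b. E i a b \<longrightarrow> E i a (pt i a) \<and> pt i a = pt i b"
    using assms unfolding pointed_D_set_def by (elim conjE)
  show "E i a (pt i a)" "pt i a = pt i b" if "i \<in> Field I" "E i a b"
    using bspec[OF 2 that(1)] that(2) by blast+
  have 3: "\<forall>i i'. (i, i') \<in> I \<longrightarrow>
      (\<forall>a\<in>dom_at M E i \<inter> dom_at M E i'. pt i' a \<in> dom_at M E i)"
    using assms unfolding pointed_D_set_def by (elim conjE)
  show "pt i' a \<in> dom_at M E i"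
    if "(i, i') \<in> I" "a \<in> dom_at M E i" "a \<in> dom_at M E i'"
    using 3 that by simp
  have 4: "\<forall>i i'. (i, i') \<in> I \<longrightarrow>
      (\<forall>a b. E i' a b \<and> a \<in> dom_at M E i \<and> b \<in> dom_at M E i \<longrightarrow> E i a b)"
    using assms unfolding pointed_D_set_def D_set_def by (elim conjE)
  show "E i a b"
    if "(i, i') \<in> I" "E i' a b" "a \<in> dom_at M E i" "b \<in> dom_at M E i"
    using 4 that by simp
qed

lemma pointed_D_set_per:
  assumes "pointed_D_set \<DD> I M E P pt" "i \<in> Field I"
  shows "E i a b \<Longrightarrow> a \<in> M \<and> b \<in> M"
    and "E i a b \<Longrightarrow> E i b a"
    and "E i a b \<Longrightarrow> E i b c \<Longrightarrow> E i a c"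
  using pointed_D_setD(2)[OF assms] unfolding per_on_def by (meson sympD transpD)+

text \<open>By surjectivity \<open>p\<close> is \<open>pt i a\<close> for some \<open>a\<close> in
  the domain. Then \<open>a\<close> and \<open>p\<close> are equivalent at \<open>i\<close>, and
  \<open>pt i\<close> is constant on equivalence classes, so each class meets \<open>P i\<close> in
  exactly one point.\<close>

lemma pointed_D_set_pt_fixes:
  assumes D: "pointed_D_set \<DD> I M E P pt" and i: "i \<in> Field I" and "p \<in> P i"
  shows "pt i p = p" "E i p p" "p \<in> dom_at M E i"
proof -
  note per = pointed_D_set_per[OF D i]
  obtain a where "a \<in> dom_at M E i" and p: "p = pt i a"
    using pointed_D_setD(3)[OF D i] \<open>p \<in> P i\<close> by blast
  then have "E i a p"
    using pointed_D_setD(5)[OF D i] by (auto simp: dom_at_def)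
  then show "pt i p = p"
    using pointed_D_setD(6)[OF D i] p by metis
  show "E i p p"
    using \<open>E i a p\<close> per(2,3) by metis
  then show "p \<in> dom_at M E i"
    using per(1) by (auto simp: dom_at_def)
qed

section \<open>The internal system as a prefactor system with embeddings\<close>

lemma internal_system_simps [simp]:
  "idx (internal_system I E P) = I"
  "elems (internal_system I E P) = P"
  "proj (internal_system I E P) i' i a' a \<longleftrightarrow> (i, i') \<in> I \<and> a' \<in> P i' \<and> a \<in> P i \<and> E i a' a"
  "emb (internal_system I E P) i i' a = a"
  by (simp_all add: internal_system_def)

text \<open>This yields the prefactor property. A witness \<open>c\<close> of consistency satisfies
  \<open>pt i' c = a'\<close>, so the last axiom of pointedness puts \<open>a'\<close> into the
  domain at \<open>i\<close>. There the equivalence of \<open>c\<close> and \<open>a'\<close> at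
  \<open>i'\<close> restricts to \<open>i\<close>, and transitivity through \<open>c\<close>
  finishes.\<close>

lemma consistent_internal_system_iff:
  assumes D: "pointed_D_set \<DD> I M E P pt"
    and le: "(i, i') \<in> I" and a': "a' \<in> P i'" and a: "a \<in> P i"
  shows "consistent (internal_system I E P) i' i a' a \<longleftrightarrow> E i a' a"
proof
  have F: "i \<in> Field I" "i' \<in> Field I"
    using le by (auto intro: FieldI1 FieldI2)
  note per = pointed_D_set_per[OF D]
  assume "consistent (internal_system I E P) i' i a' a"
  then obtain c where c: "E i' c a'" "E i c a"
    by (auto simp: consistent_def)
  have dom: "c \<in> dom_at M E i" "c \<in> dom_at M E i'"
    using per[OF F(1)] per[OF F(2)] c unfolding dom_at_def by blast+
  have "pt i' c = a'"
    using pointed_D_setD(6)[OF D F(2) c(1)] pointed_D_set_pt_fixes(1)[OF D F(2) a'] by simp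
  then have "a' \<in> dom_at M E i"
    using pointed_D_setD(7)[OF D le dom] by simp
  then have "E i c a'"
    using pointed_D_setD(8)[OF D le c(1) dom(1)] by simp
  then show "E i a' a"
    using c(2) per(2,3)[OF F(1)] by blast
next
  assume "E i a' a"
  have i': "i' \<in> Field I"
    using le by (rule FieldI2)
  \<comment> \<open>The element \<open>a'\<close> itself, taken at level \<open>i'\<close>,
    witnesses consistency.\<close>
  have "(i', i') \<in> I"
    by (rule index_set_refl[OF pointed_D_setD(1)[OF D] i'])
  then show "consistent (internal_system I E P) i' i a' a"
    using \<open>E i a' a\<close> le a a' pointed_D_set_pt_fixes(2)[OF D i' a']
    by (auto simp: consistent_def)
qed

text \<open>Finiteness is a separate premise, since the axioms of a pointed \<open>\<DD>\<close>-set
  do not bound \<open>P i\<close>. The embeddings are inclusions, so their conditions reduce to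
  monotonicity of \<open>P\<close> and to the fact that consistency inside one \<open>P i\<close> is
  equality.\<close>

lemma prefactor_system_emb_internal_system:
  assumes D: "pointed_D_set \<DD> I M E P pt" and fin: "\<And>i. i \<in> Field I \<Longrightarrow> finite (P i)"
  shows "prefactor_system_emb (internal_system I E P)"
proof -
  let ?S = "internal_system I E P"
  note I = pointed_D_setD(1)[OF D] and mono = pointed_D_setD(4)[OF D]
  have tr: "(i, i'') \<in> I" if "(i, i') \<in> I" "(i', i'') \<in> I" for i i' i''
    using I that unfolding index_set_def preorder_on_def by (blast dest: transD)
  note refl = index_set_refl[OF I]
  note pfix = pointed_D_set_pt_fixes[OF D]
  note con = consistent_internal_system_iff[OF D]
  have "is_system ?S"
    using I fin refl pfix(2) by (auto simp: is_system_def)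
  then have pre: "prefactor_system ?S"
    using con by (auto simp: prefactor_system_def)
  have con_refl: "consistent ?S i i a a" if "i \<in> Field I" "a \<in> P i" for i a
    using con[OF refl[OF that(1)] that(2) that(2)] pfix(2)[OF that] by blast
  have con_eq: "a = b" if i: "i \<in> Field I" and a: "a \<in> P i" and b: "b \<in> P i"
    and "consistent ?S i i a b" for i a b
  proof -
    have "E i a b"
      using con[OF refl[OF i] a b] that(4) by blast
    then have "pt i a = pt i b"
      by (rule pointed_D_setD(6)[OF D i])
    then show "a = b"
      using pfix(1)[OF i a] pfix(1)[OF i b] by simp
  qed
  show ?thesis
    unfolding prefactor_system_emb_def internal_system_simps
  proof (intro conjI allI impI ballI)
    show "prefactor_system ?S" by (fact pre)
    show "(\<lambda>a. a) ` P i \<subseteq> P i'" if "(i, i') \<in> I" for i i'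
      using mono[OF that] by auto
    show "consistent ?S i' i' a b"
      if le: "(i, i') \<in> I" and "a \<in> P i" "b \<in> P i" "consistent ?S i i a b" for i i' a b
      using con_eq[of i a b] con_refl[of i' a] mono[OF le] that FieldI1[OF le] FieldI2[OF le] by auto
    show "consistent ?S i i a a" if "i \<in> Field I" "a \<in> P i" for i a
      using con_refl that by blast
    show "consistent ?S i'' i'' a a" if "(i, i') \<in> I \<and> (i', i'') \<in> I" "a \<in> P i" for i i' i'' a
      using con_refl[of i'' a] mono tr that FieldI2[of i' i'' I] by blast
  \<comment> \<open>Coherence remains. The equivalence is taken at the lower index \<open>i\<close>
    in both premise and conclusion, so only the memberships and the order need to be transported to
    \<open>i''\<close>.\<close>
  qed (use mono tr in blast)+
qed

section \<open>Targets: consistency, equivalence and \<open>pt\<close> expressed through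
  \<open>Emb\<close>\<close>

locale prefactor_target =
  fixes \<DD> :: "'i rel \<Rightarrow> 'i set set"
    and S :: "('i, 'm) system_emb"
    and T :: "('i, 'm, 'a) target"
  assumes S: "prefactor_system_emb S" and T: "is_target \<DD> S T"
begin

text \<open>From here on \<open>M\<close> denotes the sets of the given system and \<open>E\<close>
  the maps into the target; in the preceding lemmas these letters stand for the carrier and the
  equivalences of a \<open>\<DD>\<close>-set.\<close>

abbreviation "I \<equiv> idx S"
abbreviation "M \<equiv> elems S"
abbreviation "E \<equiv> Emb T"
abbreviation "maps \<equiv> tproj T"

lemma index: "index_set I"
  using S by (simp add: prefactor_system_emb_def prefactor_system_def is_system_def)

lemmas idx_refl = index_set_refl[OF index]

lemma finite_elems: "i \<in> Field I \<Longrightarrow> finite (M i)"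
  using S by (simp add: prefactor_system_emb_def prefactor_system_def is_system_def)

lemma proj_refl: "i \<in> Field I \<Longrightarrow> x \<in> M i \<Longrightarrow> proj S i i x x"
  using S by (simp add: prefactor_system_emb_def prefactor_system_def is_system_def)

lemma emb_closed: "(i, i') \<in> I \<Longrightarrow> x \<in> M i \<Longrightarrow> emb S i i' x \<in> M i'"
  using S unfolding prefactor_system_emb_def by blast

lemma consistent_if_proj:
  "i \<in> Field I \<Longrightarrow> x \<in> M i \<Longrightarrow> y \<in> M i \<Longrightarrow> proj S i i x y \<Longrightarrow> consistent S i i x y"
  using S idx_refl by (simp add: prefactor_system_emb_def prefactor_system_def)

lemma maps_closed: "i \<in> Field I \<Longrightarrow> maps i a x \<Longrightarrow> a \<in> pts T \<and> x \<in> M i"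
  using T unfolding is_target_def by (elim conjE) blast

lemma Emb_closed: "i \<in> Field I \<Longrightarrow> x \<in> M i \<Longrightarrow> E i x \<in> pts T"
  using T unfolding is_target_def by (elim conjE) blast

lemma proj_if_maps: "(i, i') \<in> I \<Longrightarrow> maps i' a x' \<Longrightarrow> maps i a x \<Longrightarrow> proj S i' i x' x"
  using T maps_closed FieldI1[of i i' I] FieldI2[of i i' I] unfolding is_target_def by (elim conjE) meson

lemma Emb_emb: "(i, i') \<in> I \<Longrightarrow> x \<in> M i \<Longrightarrow> E i' (emb S i i' x) = E i x"
  using T by (simp add: is_target_def)

lemma Emb_maps:
  "(i, i') \<in> I \<Longrightarrow> x' \<in> M i' \<Longrightarrow> x \<in> M i \<Longrightarrow> proj S i' i x' x \<Longrightarrow> maps i (E i' x') x"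
  using T unfolding is_target_def by (elim conjE) meson

lemma Emb_maps_self: "i \<in> Field I \<Longrightarrow> x \<in> M i \<Longrightarrow> maps i (E i x) x"
  using Emb_maps idx_refl proj_refl by blast

lemma consistent_if_maps: "i \<in> Field I \<Longrightarrow> maps i a x \<Longrightarrow> maps i a y \<Longrightarrow> consistent S i i x y"
  using consistent_if_proj proj_if_maps[OF idx_refl] maps_closed by blast

lemma consistent_iff_Emb_eq:
  assumes "i \<in> Field I" "x \<in> M i" "y \<in> M i"
  shows "consistent S i i x y \<longleftrightarrow> E i x = E i y"
proof
  assume "consistent S i i x y"
  then show "E i x = E i y"
    using T assms unfolding is_target_def by (elim conjE) meson
next
  assume "E i x = E i y"
  then show "consistent S i i x y"
    using consistent_if_maps Emb_maps_self assms by metis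
qed

lemma Emb_eq_if_maps: "i \<in> Field I \<Longrightarrow> maps i a x \<Longrightarrow> maps i a y \<Longrightarrow> E i x = E i y"
  using consistent_if_maps consistent_iff_Emb_eq maps_closed by metis

text \<open>Trading consistency for an equation between images lets symmetry, transitivity and
  restriction to lower indices be checked by equational reasoning.\<close>

lemma target_eq_iff:
  assumes "i \<in> Field I"
  shows "target_eq S T i a b \<longleftrightarrow> (\<exists>x y. maps i a x \<and> maps i b y \<and> E i x = E i y)"
  using assms consistent_iff_Emb_eq maps_closed unfolding target_eq_def by metis

lemma target_dom_iff: "i \<in> Field I \<Longrightarrow> a \<in> target_dom S T i \<longleftrightarrow> (\<exists>x. maps i a x)"
  using maps_closed by (auto simp: dom_at_def target_eq_iff)

text \<open>The definite description is justified because all projections of \<open>a\<close> at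
  \<open>i\<close> are mutually consistent and hence share one image under
  \<open>E i\<close>.\<close>

lemma target_pt_eq: "i \<in> Field I \<Longrightarrow> maps i a x \<Longrightarrow> target_pt S T i a = E i x"
  unfolding target_pt_def target_pt_graph_def
  using maps_closed Emb_eq_if_maps by (intro the_equality) blast+

lemma target_pt_graph_iff:
  assumes "i \<in> Field I"
  shows "target_pt_graph S T i a b \<longleftrightarrow> a \<in> target_dom S T i \<and> target_pt S T i a = b"
  using assms target_dom_iff target_pt_eq maps_closed unfolding target_pt_graph_def by metis

section \<open>The pointed \<open>\<DD>\<close>-set carried by a target\<close>

lemma D_set_target: "D_set \<DD> I (pts T) (target_eq S T)"
  unfolding D_set_def
proof (intro conjI ballI allI impI)
  show "index_set I" by (fact index)
next
  fix i assume i: "i \<in> Field I"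
  show "per_on (pts T) (target_eq S T i)"
    unfolding per_on_def
  proof (intro conjI)
    show "\<forall>a b. target_eq S T i a b \<longrightarrow> a \<in> pts T \<and> b \<in> pts T"
      by (simp add: target_eq_def)
    show "symp (target_eq S T i)"
      by (rule sympI) (metis target_eq_iff[OF i])
    show "transp (target_eq S T i)"
    proof (rule transpI)
      fix a b c assume "target_eq S T i a b" "target_eq S T i b c"
      then obtain x y y' z where "maps i a x" "maps i b y" "E i x = E i y"
        and "maps i b y'" "maps i c z" "E i y' = E i z"
        unfolding target_eq_iff[OF i] by blast
      \<comment> \<open>The two hypotheses may project the middle point \<open>b\<close> to
        different elements \<open>y\<close> and \<open>y'\<close>; their images still agree.\<close>
      moreover from this have "E i y = E i y'"
        using Emb_eq_if_maps[OF i] by blast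
      ultimately show "target_eq S T i a c"
        unfolding target_eq_iff[OF i] by auto
    qed
  qed
next
  fix a assume "a \<in> pts T"
  then have "{i \<in> Field I. \<exists>x\<in>M i. maps i a x} \<in> \<DD> I"
    using T by (simp add: is_target_def)
  moreover have "{i \<in> Field I. \<exists>x\<in>M i. maps i a x} = {i \<in> Field I. a \<in> target_dom S T i}"
    using target_dom_iff maps_closed by blast
  ultimately show "{i \<in> Field I. a \<in> target_dom S T i} \<in> \<DD> I"
    by simp
next
  fix i i' a b
  assume le: "(i, i') \<in> I"
    and *: "target_eq S T i' a b \<and> a \<in> target_dom S T i \<and> b \<in> target_dom S T i"
  have F: "i \<in> Field I" "i' \<in> Field I"
    using le by (auto intro: FieldI1 FieldI2)
  obtain x' y' where 1: "maps i' a x'" "maps i' b y'" "E i' x' = E i' y'"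
    using * target_eq_iff[OF F(2)] by blast
  obtain x y where 2: "maps i a x" "maps i b y"
    using * target_dom_iff[OF F(1)] by blast
  \<comment> \<open>As projections of \<open>a\<close>, the elements \<open>x'\<close> and
    \<open>x\<close> satisfy \<open>proj S i' i x' x\<close>, which \<open>Emb\<close> turns into a
    projection of \<open>E i' x'\<close>; likewise for \<open>b\<close>. Since
    \<open>E i' x' = E i' y'\<close>, one point projects to both \<open>x\<close> and
    \<open>y\<close>.\<close>
  have "maps i (E i' x') x" "maps i (E i' y') y"
    using 1 2 le F Emb_maps proj_if_maps maps_closed by blast+
  then have "E i x = E i y"
    using 1(3) Emb_eq_if_maps[OF F(1)] by metis
  then show "target_eq S T i a b"
    using 2 target_eq_iff[OF F(1)] by blast
qed

lemma pointed_D_set_target: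
  "pointed_D_set \<DD> I (pts T) (target_eq S T) (target_P S T) (target_pt S T)"
  unfolding pointed_D_set_def
proof (intro conjI ballI allI impI)
  show "D_set \<DD> I (pts T) (target_eq S T)" by (fact D_set_target)
next
  fix i assume i: "i \<in> Field I"
  show "target_P S T i \<subseteq> pts T"
    using Emb_closed[OF i] by (auto simp: target_P_def)
  show "target_pt S T i ` target_dom S T i = target_P S T i"
  proof
    show "target_pt S T i ` target_dom S T i \<subseteq> target_P S T i"
      using maps_closed[OF i] target_pt_eq[OF i] by (auto simp: target_dom_iff[OF i] target_P_def)
    show "target_P S T i \<subseteq> target_pt S T i ` target_dom S T i"
    proof
      fix a assume "a \<in> target_P S T i"
      then obtain x where "x \<in> M i" "a = E i x"
        by (auto simp: target_P_def)
      \<comment> \<open>A point of \<open>P i\<close> is its own preimage under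
        \<open>pt i\<close>.\<close>
      then have "maps i a x" "a = E i x"
        using Emb_maps_self[OF i] by auto
      then show "a \<in> target_pt S T i ` target_dom S T i"
        using target_dom_iff[OF i] target_pt_eq[OF i] by (metis image_eqI)
    qed
  qed
next
  \<comment> \<open>The point \<open>E i x\<close> is also the image of \<open>emb S i i' x\<close>
    at level \<open>i'\<close>.\<close>
  show "target_P S T i \<subseteq> target_P S T i'" if "(i, i') \<in> I" for i i'
    using Emb_emb[OF that] emb_closed[OF that] unfolding target_P_def by (metis image_eqI image_subsetI)
next
  fix i a b assume i: "i \<in> Field I" and "target_eq S T i a b"
  then obtain x y where xy: "maps i a x" "maps i b y" "E i x = E i y"
    using target_eq_iff by blast
  then show "target_pt S T i a = target_pt S T i b"
    by (simp add: target_pt_eq[OF i])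
  \<comment> \<open>The value \<open>E i x\<close> projects to \<open>x\<close>, just as
    \<open>a\<close> does.\<close>
  show "target_eq S T i a (target_pt S T i a)"
    using xy(1) Emb_maps_self[OF i] maps_closed[OF i]
    unfolding target_pt_eq[OF i xy(1)] target_eq_iff[OF i] by blast
next
  fix i i' a
  assume le: "(i, i') \<in> I" and a: "a \<in> target_dom S T i \<inter> target_dom S T i'"
  have F: "i \<in> Field I" "i' \<in> Field I"
    using le by (auto intro: FieldI1 FieldI2)
  obtain x x' where x: "maps i a x" "maps i' a x'"
    using a target_dom_iff F by blast
  then have "maps i (E i' x') x"
    using le F Emb_maps proj_if_maps maps_closed by blast
  then show "target_pt S T i' a \<in> target_dom S T i"
    using x F by (auto simp: target_pt_eq target_dom_iff)
qed

section \<open>\<open>Emb\<close> as a homomorphism into the internal system\<close>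

lemma target_pt_Emb_if_proj:
  assumes le: "(i, i') \<in> I" and "x' \<in> M i'" "x \<in> M i" "proj S i' i x' x"
  shows "E i' x' \<in> target_dom S T i \<and> target_pt S T i (E i' x') = E i x"
  using Emb_maps[OF assms] target_pt_eq target_dom_iff FieldI1[OF le] by blast

lemma proj_if_target_pt_Emb:
  assumes st: "stable S" and le: "(i, i') \<in> I" and x': "x' \<in> M i'" and x: "x \<in> M i"
    and "E i' x' \<in> target_dom S T i" "target_pt S T i (E i' x') = E i x"
  shows "proj S i' i x' x"
proof -
  have F: "i \<in> Field I" "i' \<in> Field I"
    using le by (auto intro: FieldI1 FieldI2)
  obtain y where y: "maps i (E i' x') y"
    using assms target_dom_iff F by blast
  then have yM: "y \<in> M i" and "E i y = E i x"
    using assms(6) target_pt_eq[OF F(1)] maps_closed[OF F(1)] by auto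
  then have "consistent S i i y x"
    using consistent_iff_Emb_eq F(1) x by blast
  moreover have "proj S i' i x' y"
    using y le Emb_maps_self[OF F(2) x'] proj_if_maps by blast
  ultimately show ?thesis
    using st le x x' yM unfolding stable_def by blast
qed

text \<open>Since \<open>E i x\<close> projects to \<open>x\<close>, being equivalent to it means
  having it as value of \<open>pt i\<close>. Membership in the domain must accompany the equation,
  because the definite description behind \<open>target_pt\<close> is meaningful only there.\<close>

lemma target_eq_Emb_iff:
  assumes "(i, i') \<in> I" and "x' \<in> M i'" and x: "x \<in> M i"
  shows "target_eq S T i (E i' x') (E i x) \<longleftrightarrow>
    E i' x' \<in> target_dom S T i \<and> target_pt S T i (E i' x') = E i x"
proof -
  have i: "i \<in> Field I"
    using assms(1) by (rule FieldI1)
  show ?thesis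
    using target_eq_iff[OF i] target_dom_iff[OF i] target_pt_eq[OF i] Emb_maps_self[OF i x]
    by metis
qed

lemma prefactor_system_emb_AP: "prefactor_system_emb (target_AP S T)"
  by (rule prefactor_system_emb_internal_system[OF pointed_D_set_target])
    (simp add: target_P_def finite_elems)

lemma Emb_strong_homomorphism:
  assumes "stable S"
  shows "strong_homomorphism S (target_AP S T) id E"
proof -
  have "proj S i' i x' x \<longleftrightarrow> proj (target_AP S T) i' i (E i' x') (E i x)"
    if "(i, i') \<in> I" "x' \<in> M i'" "x \<in> M i" for i i' x' x
  proof -
    have "proj (target_AP S T) i' i (E i' x') (E i x) \<longleftrightarrow> target_eq S T i (E i' x') (E i x)"
      using that by (simp add: target_P_def)
    then show ?thesis
      using target_eq_Emb_iff[OF that] target_pt_Emb_if_proj[OF that]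
        proj_if_target_pt_Emb[OF assms that] by blast
  qed
  then show ?thesis
    using S prefactor_system_emb_AP Emb_emb
    by (simp add: strong_homomorphism_def homomorphism_def target_P_def)
qed

text \<open>Surjectivity is built in: \<open>target_P\<close> consists of images under
  \<open>Emb\<close>, and the index map is \<open>id\<close>.\<close>

lemma Emb_surjective_homomorphism:
  assumes "stable S"
  shows "surjective_homomorphism S (target_AP S T) id E"
  using Emb_strong_homomorphism[OF assms]
  by (simp add: strong_homomorphism_def surjective_homomorphism_def target_P_def)

text \<open>When consistency is equality, stability is immediate and each \<open>E i\<close> is
  injective, hence a bijection onto \<open>P i\<close>. Strongness then makes the inverse maps
  preserve projections.\<close>

lemma Emb_isomorphism:
  assumes eq: "\<And>i x y. i \<in> Field I \<Longrightarrow> x \<in> M i \<Longrightarrow> y \<in> M i \<Longrightarrow> consistent S i i x y \<longleftrightarrow> x = y"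
  shows "isomorphism S (target_AP S T) id E"
proof -
  have "stable S"
    using eq FieldI1 unfolding stable_def by metis
  note strong = Emb_strong_homomorphism[OF this]
  define \<Psi> where "\<Psi> i = inv_into (M i) (E i)" for i
  have inj: "inj_on (E i) (M i)" if "i \<in> Field I" for i
    using that consistent_iff_Emb_eq eq by (auto intro!: inj_onI)
  have \<Psi>_Emb: "\<Psi> i (E i x) = x" if "i \<in> Field I" "x \<in> M i" for i x
    using that inj by (simp add: \<Psi>_def)
  have "homomorphism (target_AP S T) S id \<Psi>"
    unfolding homomorphism_def internal_system_simps
  proof (intro conjI allI impI ballI)
    fix i i' assume le: "(i, i') \<in> I"
    then have F: "i \<in> Field I" "i' \<in> Field I"
      by (auto intro: FieldI1 FieldI2)
    show "(id i, id i') \<in> I"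
      using le by simp
    show "\<Psi> i' a = emb S (id i) (id i') (\<Psi> i a)" if a: "a \<in> target_P S T i" for a
    proof -
      obtain x where x: "x \<in> M i" "a = E i x"
        using a by (auto simp: target_P_def)
      \<comment> \<open>Both sides equal \<open>emb S i i' x\<close>: the point \<open>a\<close> is
        also \<open>E i' (emb S i i' x)\<close>, and \<open>\<Psi> i'\<close> inverts
        \<open>E i'\<close>.\<close>
      then show ?thesis
        using \<Psi>_Emb[OF F(2) emb_closed[OF le x(1)]] \<Psi>_Emb[OF F(1) x(1)] Emb_emb[OF le x(1)]
        by simp
    qed
    show "proj S (id i') (id i) (\<Psi> i' a') (\<Psi> i a)"
      if a': "a' \<in> target_P S T i'" and a: "a \<in> target_P S T i"
        and "(i, i') \<in> I \<and> a' \<in> target_P S T i' \<and> a \<in> target_P S T i \<and> target_eq S T i a' a"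
      for a' a
    proof -
      obtain x' x where x: "x' \<in> M i'" "a' = E i' x'" "x \<in> M i" "a = E i x"
        using a a' by (auto simp: target_P_def)
      then have "proj S i' i x' x"
        using strong le that by (auto simp: strong_homomorphism_def)
      then show ?thesis
        using x \<Psi>_Emb F by simp
    qed
  qed (use S prefactor_system_emb_AP \<Psi>_Emb in \<open>auto simp: target_P_def\<close>)
  then show ?thesis
    using strong \<Psi>_Emb unfolding isomorphism_def strong_homomorphism_def
    by (intro conjI exI[of _ id] exI[of _ \<Psi>]) (auto simp: target_P_def)
qed

end

theorem proposition3p13:
  fixes \<DD> :: "'u index rel \<Rightarrow> 'u index set set"
    and S :: "('u index, 'm) system_emb"
    and T :: "('u index, 'm, 'a) target"
  assumes "filter_family \<DD>"
    and "prefactor_system_emb S"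
    and "is_target \<DD> S T"
  shows "(\<forall>i\<in>Field (idx S). \<forall>a\<in>pts T. \<forall>b.
            target_pt_graph S T i a b \<longleftrightarrow> a \<in> target_dom S T i \<and> target_pt S T i a = b) \<and>
         pointed_D_set \<DD> (idx S) (pts T) (target_eq S T) (target_P S T) (target_pt S T) \<and>
         (\<forall>i\<in>Field (idx S). \<forall>x\<in>elems S i. \<forall>y\<in>elems S i.
            consistent S i i x y \<longleftrightarrow> Emb T i x = Emb T i y) \<and>
         (\<forall>i i'. (i, i') \<in> idx S \<longrightarrow> (\<forall>x'\<in>elems S i'. \<forall>x\<in>elems S i.
            proj S i' i x' x \<longrightarrow>
              Emb T i' x' \<in> target_dom S T i \<and> target_pt S T i (Emb T i' x') = Emb T i x)) \<and>
         (stable S \<longrightarrow> (\<forall>i i'. (i, i') \<in> idx S \<longrightarrow> (\<forall>x'\<in>elems S i'. \<forall>x\<in>elems S i.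
            Emb T i' x' \<in> target_dom S T i \<and> target_pt S T i (Emb T i' x') = Emb T i x \<longrightarrow>
              proj S i' i x' x))) \<and>
         (stable S \<longrightarrow>
            strong_homomorphism S (target_AP S T) id (Emb T) \<and>
            surjective_homomorphism S (target_AP S T) id (Emb T)) \<and>
         ((\<forall>i\<in>Field (idx S). \<forall>x\<in>elems S i. \<forall>y\<in>elems S i.
             (consistent S i i x y \<longleftrightarrow> proj S i i x y) \<and> (proj S i i x y \<longleftrightarrow> x = y)) \<longrightarrow>
            isomorphism S (target_AP S T) id (Emb T))"
proof -
  interpret prefactor_target \<DD> S T
    using assms(2,3) by unfold_locales
  show ?thesis
    using target_pt_graph_iff pointed_D_set_target consistent_iff_Emb_eq target_pt_Emb_if_proj
      proj_if_target_pt_Emb Emb_strong_homomorphism Emb_surjective_homomorphism Emb_isomorphism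
    by (intro conjI) (blast | simp)+
qed

end
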